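(* A permutation $w\in S_n$ avoids all patterns in $\mathcal{P}$ if and only if its Rothe diagram $D(w)$ satisfies both of the following conditions. (A) For every $p$ such that $(p,w(p))$ is an outer corner of $\operatorname{dom}(w)$ and $(p+1,w(p)+1)\in D(w)$: letting $D_p:=\{(i,j)\in D(w): i>p,\ j>w(p)\}$ and letting $D_p'\subset D_p$ be the region connected to $(p+1,w(p)+1)$, every $(i,j)\in D_p\setminus D_p'$ satisfies $i=p+1$ or $j=w(p)+1$. (B) For every $(p,q)\in D(w)$ that is the northwest corner of a non-dominant region and satisfies either (a) $w(p-1)\ne q-1$, or (b) $q\ge3$, $w(p-1)=q-1$ and $w^{-1}(q-2)\le p-2$: the set $D_{p,q}:=\{(i,j)\in D(w): i\ge p,\ j\ge q\}$ is either entirely contained in row $p$ or entirely contained in column $q$; and furthermore, if $(s,t)\in D(w)$ with both $s<p$ and $t<q$, then $(s,t)\in\operatorname{dom}(w)$.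
   Context: $\mathcal{P}=\{12543, 13254, 13524, 14253, 13542, 15243, 21543, 125634, 215634, 315624, 251634, 315642, 261534\}$ (one-line notation); $w$ avoids $\mathcal{P}$ if it contains none of these as a permutation pattern. $D(w)=\{(i,j)\in[n]^2:w(i)>j,\ w^{-1}(j)>i\}$ is the Rothe diagram (matrix coordinates: $i$ is the row, $j$ the column). A region of $D(w)$ is a maximal subset connected via (horizontal or vertical) adjacency of cells. The dominant part is $\operatorname{dom}(w)=\{(i,j)\in D(w): (k,w(k))\notin[i]\times[j]\text{ for all }k\in[n]\}$; when nonempty it is the region containing $(1,1)$. A non-dominant region is a region other than $\operatorname{dom}(w)$. $(p,w(p))$ is an outer corner of $\operatorname{dom}(w)$ if $(p-1,w(p))\in\operatorname{dom}(w)$ (required only when $p>1$) and $(p,w(p)-1)\in\operatorname{dom}(w)$ (required only when $w(p)>1$); in particular if $\operatorname{dom}(w)=\emptyset$ then $w(1)=1$ and $(1,1)$ is an outer corner. $(i,j)\in D(w)$ is a northwest corner if $(i-1,j)\notin D(w)$ and $(i,j-1)\notin D(w)$. *)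

theory Defs
  imports "HOL-Combinatorics.Permutations"
begin

text \<open>
  A permutation in the symmetric group on \<open>n\<close> letters is a function \<open>w\<close> with
  \<open>w permutes {1..n}\<close>; patterns are given in one-line notation as lists.
  Cells are pairs (row, column), both indexed from 1.
\<close>

type_synonym cell = "nat \<times> nat"

definition contains_pattern :: "nat \<Rightarrow> (nat \<Rightarrow> nat) \<Rightarrow> nat list \<Rightarrow> bool" where
  "contains_pattern n w v \<longleftrightarrow>
     (\<exists>f. strict_mono_on {..<length v} f \<and> f ` {..<length v} \<subseteq> {1..n} \<and>
          (\<forall>a<length v. \<forall>b<length v. w (f a) < w (f b) \<longleftrightarrow> v ! a < v ! b))"

definition patterns :: "nat list set" where
  "patterns =
     {[1,2,5,4,3], [1,3,2,5,4], [1,3,5,2,4], [1,4,2,5,3], [1,3,5,4,2],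
      [1,5,2,4,3], [2,1,5,4,3],
      [1,2,5,6,3,4], [2,1,5,6,3,4], [3,1,5,6,2,4], [2,5,1,6,3,4],
      [3,1,5,6,4,2], [2,6,1,5,3,4]}"

definition avoids_patterns :: "nat \<Rightarrow> (nat \<Rightarrow> nat) \<Rightarrow> bool" where
  "avoids_patterns n w \<longleftrightarrow> (\<forall>v\<in>patterns. \<not> contains_pattern n w v)"

definition rothe :: "nat \<Rightarrow> (nat \<Rightarrow> nat) \<Rightarrow> cell set" where
  "rothe n w = {(i, j). i \<in> {1..n} \<and> j \<in> {1..n} \<and> w i > j \<and> inv w j > i}"

definition adjacent :: "cell \<Rightarrow> cell \<Rightarrow> bool" where
  "adjacent c d \<longleftrightarrow>
     (fst c = fst d \<and> (snd d = Suc (snd c) \<or> snd c = Suc (snd d))) \<or>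
     (snd c = snd d \<and> (fst d = Suc (fst c) \<or> fst c = Suc (fst d)))"

definition connected_cells :: "cell set \<Rightarrow> bool" where
  "connected_cells S \<longleftrightarrow>
     (\<forall>c\<in>S. \<forall>d\<in>S. (c, d) \<in> {(x, y). x \<in> S \<and> y \<in> S \<and> adjacent x y}\<^sup>*)"

text \<open>Nonemptiness only matters for \<open>X = {}\<close>, which has no regions.\<close>

definition regions :: "cell set \<Rightarrow> cell set set" where
  "regions X =
     {R. R \<noteq> {} \<and> R \<subseteq> X \<and> connected_cells R \<and>
         (\<forall>S. R \<subseteq> S \<and> S \<subseteq> X \<and> connected_cells S \<longrightarrow> S = R)}"

definition dominant_part :: "nat \<Rightarrow> (nat \<Rightarrow> nat) \<Rightarrow> cell set" where
  "dominant_part n w =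
     {(i, j). (i, j) \<in> rothe n w \<and> (\<forall>k\<in>{1..n}. (k, w k) \<notin> {1..i} \<times> {1..j})}"

text \<open>The outer corner meant by \<open>outer_corner_at n w p\<close> is the cell \<open>(p, w p)\<close>.\<close>

definition outer_corner_at :: "nat \<Rightarrow> (nat \<Rightarrow> nat) \<Rightarrow> nat \<Rightarrow> bool" where
  "outer_corner_at n w p \<longleftrightarrow>
     p \<in> {1..n} \<and>
     (p > 1 \<longrightarrow> (p - 1, w p) \<in> dominant_part n w) \<and>
     (w p > 1 \<longrightarrow> (p, w p - 1) \<in> dominant_part n w)"

text \<open>
  Row 0 and column 0 never meet the diagram, so for cells in the first row or column
  the corresponding non-membership holds automatically.
\<close>

definition northwest_corner :: "nat \<Rightarrow> (nat \<Rightarrow> nat) \<Rightarrow> nat \<Rightarrow> nat \<Rightarrow> bool" where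
  "northwest_corner n w i j \<longleftrightarrow>
     (i, j) \<in> rothe n w \<and> (i - 1, j) \<notin> rothe n w \<and> (i, j - 1) \<notin> rothe n w"

definition condition_A :: "nat \<Rightarrow> (nat \<Rightarrow> nat) \<Rightarrow> bool" where
  "condition_A n w \<longleftrightarrow>
     (\<forall>p. outer_corner_at n w p \<and> (p + 1, w p + 1) \<in> rothe n w \<longrightarrow>
        (let D\<^sub>p = {(i, j). (i, j) \<in> rothe n w \<and> i > p \<and> j > w p} in
         \<forall>R\<in>regions (rothe n w). (p + 1, w p + 1) \<in> R \<longrightarrow>
           (\<forall>(i, j) \<in> D\<^sub>p - R. i = p + 1 \<or> j = w p + 1)))"

text \<open>
  A cell \<open>(p, q)\<close> in a non-dominant region has \<open>p \<ge> 2\<close> and \<open>q \<ge> 2\<close> (a diagram cell in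
  the first row or column lies in the dominant part), so the natural-number subtractions
  below do not truncate; for \<open>q - 2\<close> this also uses \<open>q \<ge> 3\<close>.
\<close>

definition condition_B :: "nat \<Rightarrow> (nat \<Rightarrow> nat) \<Rightarrow> bool" where
  "condition_B n w \<longleftrightarrow>
     (\<forall>p q. northwest_corner n w p q \<and>
        (\<exists>R\<in>regions (rothe n w). R \<noteq> dominant_part n w \<and> (p, q) \<in> R) \<and>
        (w (p - 1) \<noteq> q - 1 \<or>
         (q \<ge> 3 \<and> w (p - 1) = q - 1 \<and> inv w (q - 2) \<le> p - 2)) \<longrightarrow>
        (let D\<^sub>p\<^sub>q = {(i, j). (i, j) \<in> rothe n w \<and> i \<ge> p \<and> j \<ge> q} in
         (\<forall>(i, j) \<in> D\<^sub>p\<^sub>q. i = p) \<or> (\<forall>(i, j) \<in> D\<^sub>p\<^sub>q. j = q)) \<and>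
        (\<forall>s t. (s, t) \<in> rothe n w \<and> s < p \<and> t < q \<longrightarrow> (s, t) \<in> dominant_part n w))"

end

theory Submission
  imports Defs
begin

text \<open>
  Call the number of points \<open>(k, w k)\<close> strictly northwest of a diagram cell its rank. The rank is
  constant on regions, and two diagram cells with the same northwest points, one weakly
  northwest of the other, span a rectangle inside the diagram. Both conditions can
  therefore be restated without regions: together they forbid exactly

  \<^item> a cell of rank at least 1 strictly northwest of a cell of rank at least 2, and

  \<^item> a cell of rank at least 2 with another cell below it in its column and another
    one to its right in its row.

  A cell is an inversion, so each configuration consists of at most six points of the
  permutation, and sorting out their relative order gives the thirteen patterns. The second
  configuration accounts for \<open>12543\<close>, \<open>21543\<close>, \<open>125634\<close> and \<open>215634\<close>.
\<close>

section \<open>Regions as connected components\<close>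

definition component :: "cell set \<Rightarrow> cell \<Rightarrow> cell set" where
  "component X c = {d. (c, d) \<in> {(x, y). x \<in> X \<and> y \<in> X \<and> adjacent x y}\<^sup>*}"

lemma adjacent_commute: "adjacent c d \<longleftrightarrow> adjacent d c"
  unfolding adjacent_def by auto

lemma component_refl: "c \<in> component X c"
  unfolding component_def by simp

lemma component_step:
  assumes "d \<in> component X c" "d \<in> X" "e \<in> X" "adjacent d e"
  shows "e \<in> component X c"
  using assms unfolding component_def by (auto intro: rtrancl_into_rtrancl)

lemma component_trans:
  assumes "d \<in> component X c" "e \<in> component X d"
  shows "e \<in> component X c"
  using assms unfolding component_def by (auto intro: rtrancl_trans)

lemma component_sym:
  assumes "d \<in> component X c"
  shows "c \<in> component X d"
proof -
  have "sym {(x, y). x \<in> X \<and> y \<in> X \<and> adjacent x y}"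
    unfolding sym_def by (auto simp: adjacent_commute)
  from sym_rtrancl[OF this] show ?thesis
    using assms unfolding component_def by (auto dest: symD)
qed

lemma component_induct [consumes 1, case_names base step]:
  assumes "d \<in> component X c" "P c"
    and "\<And>d e. d \<in> component X c \<Longrightarrow> d \<in> X \<Longrightarrow> e \<in> X \<Longrightarrow> adjacent d e \<Longrightarrow> P d \<Longrightarrow> P e"
  shows "P d"
  using assms(1) unfolding component_def mem_Collect_eq
  by (induction rule: rtrancl_induct) (use assms in \<open>auto simp: component_def\<close>)

lemma component_subset:
  assumes "c \<in> X"
  shows "component X c \<subseteq> X"
proof
  fix d assume "d \<in> component X c"
  then show "d \<in> X" by (induction rule: component_induct) (use assms in auto)
qed

lemma connected_cells_iff: "connected_cells S \<longleftrightarrow> (\<forall>c\<in>S. S \<subseteq> component S c)"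
  unfolding connected_cells_def component_def by auto

lemma component_mono: "S \<subseteq> X \<Longrightarrow> component S c \<subseteq> component X c"
  unfolding component_def by (auto elim: rtrancl_mono[THEN subsetD, rotated])

text \<open>Connectedness asks for paths inside the set itself. A path in \<open>X\<close> from
  \<open>c\<close> visits only cells reachable from \<open>c\<close>, so it never leaves the
  component.\<close>

lemma connected_component: "connected_cells (component X c)"
  unfolding connected_cells_iff
proof (intro ballI subsetI)
  let ?K = "component X c"
  have from_c: "d \<in> component ?K c" if "d \<in> ?K" for d
    using that
  proof (induction rule: component_induct)
    case base show ?case by (rule component_refl)
  next
    case (step d e)
    then show ?case
      by (intro component_step[of d ?K c e]) (auto intro: component_step)
  qed
  fix d e assume "d \<in> ?K" "e \<in> ?K"
  then show "e \<in> component ?K d"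
    by (blast intro: from_c component_sym component_trans)
qed

lemma component_in_regions:
  assumes "c \<in> X"
  shows "component X c \<in> regions X"
  unfolding regions_def
proof (clarsimp simp: connected_component component_subset[OF assms], intro conjI allI impI)
  show "component X c \<noteq> {}" using component_refl by blast
next
  fix S assume S: "component X c \<subseteq> S \<and> S \<subseteq> X \<and> connected_cells S"
  then have "S \<subseteq> component S c"
    using component_refl[of c X] unfolding connected_cells_iff by blast
  with S show "S = component X c" using component_mono[of S X c] by blast
qed

text \<open>Turns the quantification over regions in both conditions into a statement about the
  component of one known cell.\<close>

lemma region_eq_component:
  assumes "R \<in> regions X" "c \<in> R"
  shows "R = component X c"
proof -
  have R: "R \<subseteq> X" "connected_cells R"
    and max: "\<And>S. R \<subseteq> S \<Longrightarrow> S \<subseteq> X \<Longrightarrow> connected_cells S \<Longrightarrow> S = R"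
    using assms(1) unfolding regions_def by auto
  have "R \<subseteq> component X c"
    using R assms(2) component_mono[OF R(1)] unfolding connected_cells_iff by blast
  with max[OF this] show ?thesis
    using R assms(2) connected_component component_subset by blast
qed

text \<open>Walk along the top row of the rectangle, then down its last column.\<close>

lemma rectangle_component:
  assumes "{i..i'} \<times> {j..j'} \<subseteq> X" "i \<le> i'" "j \<le> j'"
  shows "(i', j') \<in> component X (i, j)"
proof -
  have "(i, l) \<in> component X (i, j)" if "j \<le> l" "l \<le> j'" for l
    using that(1,2)
  proof (induction l rule: dec_induct)
    case base show ?case by (rule component_refl)
  next
    case (step l)
    show ?case
      by (rule component_step[of "(i, l)"]) (use step assms in \<open>auto simp: adjacent_def\<close>)
  qed
  then have row: "(i, j') \<in> component X (i, j)" using assms by simp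
  have "(k, j') \<in> component X (i, j)" if "i \<le> k" "k \<le> i'" for k
    using that(1,2)
  proof (induction k rule: dec_induct)
    case base show ?case by (rule row)
  next
    case (step k)
    show ?case
      by (rule component_step[of "(k, j')"]) (use step assms in \<open>auto simp: adjacent_def\<close>)
  qed
  then show ?thesis using assms by simp
qed


section \<open>Diagram cells and their rank\<close>

text \<open>The set of rows is kept rather than its size, because inclusions between these sets are
  what produce rectangles inside the diagram.\<close>

definition nw_points :: "nat \<Rightarrow> (nat \<Rightarrow> nat) \<Rightarrow> cell \<Rightarrow> nat set" where
  "nw_points n w c = {k \<in> {1..n}. k < fst c \<and> w k < snd c}"

definition rank_ge2 :: "nat \<Rightarrow> (nat \<Rightarrow> nat) \<Rightarrow> cell \<Rightarrow> bool" where
  "rank_ge2 n w c \<longleftrightarrow> (\<exists>a\<in>nw_points n w c. \<exists>b\<in>nw_points n w c. a \<noteq> b)"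

definition nested_cells :: "nat \<Rightarrow> (nat \<Rightarrow> nat) \<Rightarrow> bool" where
  "nested_cells n w \<longleftrightarrow>
     (\<exists>c\<in>rothe n w. \<exists>d\<in>rothe n w. fst c < fst d \<and> snd c < snd d \<and>
        nw_points n w c \<noteq> {} \<and> rank_ge2 n w d)"

definition hook_cells :: "nat \<Rightarrow> (nat \<Rightarrow> nat) \<Rightarrow> bool" where
  "hook_cells n w \<longleftrightarrow>
     (\<exists>p q i j. (p, q) \<in> rothe n w \<and> (i, q) \<in> rothe n w \<and> (p, j) \<in> rothe n w \<and>
        p < i \<and> q < j \<and> rank_ge2 n w (p, q))"

lemma nw_points_mono:
  "fst c \<le> fst d \<Longrightarrow> snd c \<le> snd d \<Longrightarrow> nw_points n w c \<subseteq> nw_points n w d"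
  unfolding nw_points_def by auto

lemma rank_ge2_mono:
  "rank_ge2 n w c \<Longrightarrow> fst c \<le> fst d \<Longrightarrow> snd c \<le> snd d \<Longrightarrow> rank_ge2 n w d"
  using nw_points_mono unfolding rank_ge2_def by blast

lemma rank_ge2_nonempty: "rank_ge2 n w c \<Longrightarrow> nw_points n w c \<noteq> {}"
  unfolding rank_ge2_def by blast

lemma nested_cellsI:
  assumes "(i, j) \<in> rothe n w" "(i', j') \<in> rothe n w" "i < i'" "j < j'"
    and "nw_points n w (i, j) \<noteq> {}" "rank_ge2 n w (i', j')"
  shows "nested_cells n w"
  unfolding nested_cells_def using assms
  by (intro bexI[of _ "(i, j)"] bexI[of _ "(i', j')"]) simp_all

section \<open>Cells as inversions of a fixed permutation\<close>

context
  fixes n :: nat and w :: "nat \<Rightarrow> nat"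
  assumes w: "w permutes {1..n}"
begin

lemma perm_range: "k \<in> {1..n} \<Longrightarrow> w k \<in> {1..n}"
  using permutes_in_image[OF w] by blast

lemma perm_eq_iff: "w a = w b \<longleftrightarrow> a = b"
  using permutes_inj[OF w] by (auto dest: injD)

lemma perm_inv: "inv w (w k) = k" "w (inv w k) = k"
  using permutes_inverses[OF w] by auto

lemma inv_range: "k \<in> {1..n} \<Longrightarrow> inv w k \<in> {1..n}"
  using permutes_in_image[OF permutes_inv[OF w]] by blast

text \<open>A column is addressed by the row \<open>k\<close> of its point, so that a diagram cell
  becomes the inversion formed by rows \<open>i\<close> and \<open>k\<close>.\<close>

lemma inversion_in_rothe:
  "(i, w k) \<in> rothe n w \<longleftrightarrow> i \<in> {1..n} \<and> k \<in> {1..n} \<and> i < k \<and> w k < w i"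
  using permutes_in_image[OF w, of k] unfolding rothe_def by (auto simp: perm_inv)

lemma rotheE:
  assumes "(i, j) \<in> rothe n w"
  obtains k where "j = w k" "i \<in> {1..n}" "k \<in> {1..n}" "i < k" "w k < w i"
proof (rule that[of "inv w j"])
  show "j = w (inv w j)" by (simp add: perm_inv)
qed (use assms inversion_in_rothe[of i "inv w j"] in \<open>simp_all add: perm_inv\<close>)

text \<open>A step to the right could only add the point of the left column, but that point lies
  below the cell. A step down could only add the point of the upper row, which lies to the right of
  the cell.\<close>

lemma nw_points_adjacent:
  assumes "c \<in> rothe n w" "d \<in> rothe n w" "adjacent c d"
  shows "nw_points n w c = nw_points n w d"
proof -
  have right: "nw_points n w (i, Suc j) = nw_points n w (i, j)" if "(i, j) \<in> rothe n w" for i j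
    using that by (auto simp: nw_points_def less_Suc_eq elim!: rotheE dest: perm_eq_iff[THEN iffD1])
  have down: "nw_points n w (Suc i, j) = nw_points n w (i, j)" if "(i, j) \<in> rothe n w" for i j
    using that by (auto simp: nw_points_def less_Suc_eq elim!: rotheE)
  show ?thesis
    using assms right down unfolding adjacent_def by (cases c; cases d) auto
qed

lemma nw_points_component:
  assumes "d \<in> component (rothe n w) c"
  shows "nw_points n w d = nw_points n w c"
  using assms by (induction rule: component_induct) (auto dest: nw_points_adjacent)

text \<open>A missing cell of the rectangle would have a point weakly to its left or weakly above
  it. That point would be northwest of \<open>(i', j')\<close>, hence of \<open>(i, j)\<close>, and
  so outside the rows or columns of the rectangle.\<close>

lemma rothe_between:
  assumes c: "1 \<le> i" "1 \<le> j" and d: "(i', j') \<in> rothe n w"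
    and "nw_points n w (i', j') \<subseteq> nw_points n w (i, j)"
  shows "{i..i'} \<times> {j..j'} \<subseteq> rothe n w"
proof clarify
  fix k l assume k: "k \<in> {i..i'}" and l: "l \<in> {j..j'}"
  from d obtain m where m: "j' = w m" "i' \<in> {1..n}" "m \<in> {1..n}" "i' < m" "w m < w i'"
    by (rule rotheE)
  have old: "r < i \<and> w r < j" if "r \<in> {1..n}" "r < i'" "w r < j'" for r
    using assms(4) that by (auto simp: nw_points_def)
  define r where "r = inv w l"
  have l_eq: "l = w r" by (simp add: r_def perm_inv)
  have l_range: "l \<in> {1..n}" using l c m perm_range[of m] by auto
  then have r_range: "r \<in> {1..n}" unfolding r_def by (rule inv_range)
  have "w k > j'"
  proof (rule ccontr)
    assume "\<not> w k > j'"
    moreover have "k \<noteq> m" "k \<noteq> i' \<or> w k > j'" using k m by auto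
    ultimately have "w k < j'" "k < i'" using k m perm_eq_iff[of k m] by auto
    then have "k < i" using old[of k] k c m by auto
    then show False using k by simp
  qed
  moreover have "r > i'"
  proof (rule ccontr)
    assume "\<not> r > i'"
    moreover have "r \<noteq> i'" using l l_eq m by auto
    moreover have "r \<noteq> m" using calculation m by auto
    ultimately have "w r < j'" "r < i'" using l l_eq m perm_eq_iff[of r m] by auto
    then have "w r < j" using old[of r] r_range by auto
    then show False using l l_eq by simp
  qed
  ultimately show "(k, l) \<in> rothe n w"
    using k l l_eq r_range c m unfolding l_eq inversion_in_rothe by auto
qed

text \<open>The definition tests a closed rectangle and \<open>nw_points\<close> a strict one. They
  agree because a diagram cell has no point weakly left of it in its row or weakly above it in its
  column.\<close>

lemma dominant_part_eq: "dominant_part n w = {c \<in> rothe n w. nw_points n w c = {}}"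
proof -
  have "(\<forall>k\<in>{1..n}. (k, w k) \<notin> {1..i} \<times> {1..j}) \<longleftrightarrow> nw_points n w (i, j) = {}"
    if ij: "(i, j) \<in> rothe n w" for i j
  proof -
    from ij obtain m where m: "j = w m" "i < m" "w m < w i" by (rule rotheE)
    have "(k, w k) \<in> {1..i} \<times> {1..j} \<longleftrightarrow> k < i \<and> w k < j" if "k \<in> {1..n}" for k
      using m that perm_range[OF that] perm_eq_iff[of k m] by (cases "k = i"; cases "k = m") auto
    then show ?thesis by (auto simp: nw_points_def)
  qed
  then show ?thesis unfolding dominant_part_def by auto
qed

text \<open>A cell of rank 0 spans a diagram rectangle with \<open>(1, 1)\<close>, so all such cells
  are connected through \<open>(1, 1)\<close>; constancy of the rank keeps the component from
  growing further.\<close>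

lemma dominant_part_component:
  assumes "c \<in> dominant_part n w"
  shows "component (rothe n w) c = dominant_part n w"
proof -
  have corner: "d \<in> component (rothe n w) (1, 1) \<and> (1, 1) \<in> rothe n w" if "d \<in> dominant_part n w" for d
  proof -
    obtain i j where d: "d = (i, j)" by force
    have ij: "(i, j) \<in> rothe n w" "nw_points n w (i, j) = {}" using that d by (auto simp: dominant_part_eq)
    then have "1 \<le> i" "1 \<le> j" by (auto simp: rothe_def)
    moreover have rect: "{1..i} \<times> {1..j} \<subseteq> rothe n w"
      using rothe_between[of 1 1 i j] ij by simp
    ultimately have "(1, 1) \<in> rothe n w" by auto
    with rectangle_component[OF rect] \<open>1 \<le> i\<close> \<open>1 \<le> j\<close> d show ?thesis by simp
  qed
  show ?thesis
  proof
    show "component (rothe n w) c \<subseteq> dominant_part n w"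
      using assms component_subset[of c "rothe n w"] nw_points_component[of _ c]
      by (auto simp: dominant_part_eq)
    show "dominant_part n w \<subseteq> component (rothe n w) c"
      using corner assms by (blast intro: component_sym component_trans)
  qed
qed

text \<open>Walking up and left inside the diagram as long as possible does not change the rank.\<close>

lemma northwest_corner_exists:
  assumes "(i, j) \<in> rothe n w"
  obtains p q where "northwest_corner n w p q" "p \<le> i" "q \<le> j"
    "nw_points n w (p, q) = nw_points n w (i, j)"
proof -
  have "\<exists>p q. northwest_corner n w p q \<and> p \<le> i \<and> q \<le> j \<and>
      nw_points n w (p, q) = nw_points n w (i, j)"
    using assms
  proof (induction "i + j" arbitrary: i j rule: less_induct)
    case less
    have pos: "1 \<le> i" "1 \<le> j" using less.prems by (auto simp: rothe_def)
    consider "northwest_corner n w i j" | "(i - 1, j) \<in> rothe n w" | "(i, j - 1) \<in> rothe n w"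
      using less.prems unfolding northwest_corner_def by blast
    then show ?case
    proof cases
      case 1 then show ?thesis by blast
    next
      case 2
      then have "nw_points n w (i - 1, j) = nw_points n w (i, j)"
        using less.prems pos by (intro nw_points_adjacent) (auto simp: adjacent_def)
      with less.hyps[of "i - 1" j] 2 pos show ?thesis
        by (metis add_less_mono1 diff_le_self diff_less le_trans less_numeral_extra(1) less_le_trans)
    next
      case 3
      then have "nw_points n w (i, j - 1) = nw_points n w (i, j)"
        using less.prems pos by (intro nw_points_adjacent) (auto simp: adjacent_def)
      with less.hyps[of i "j - 1"] 3 pos show ?thesis
        by (metis nat_add_left_cancel_less diff_le_self diff_less le_trans less_numeral_extra(1) less_le_trans)
    qed
  qed
  with that show ?thesis by blast
qed

text \<open>The cells above and to the left of the corner are missing because of the points in row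
  \<open>p - 1\<close> and in column \<open>q - 1\<close>. These coincide exactly when
  \<open>w (p - 1) = q - 1\<close>, which is what alternatives (a) and (b) of condition B
  distinguish.\<close>

lemma northwest_corner_points:
  assumes "northwest_corner n w p q" "nw_points n w (p, q) \<noteq> {}"
  shows "2 \<le> p" "2 \<le> q" "p - 1 \<in> nw_points n w (p, q)" "inv w (q - 1) \<in> nw_points n w (p, q)"
proof -
  from assms(2) obtain a where a: "a \<in> {1..n}" "a < p" "w a < q"
    unfolding nw_points_def by auto
  then show p: "2 \<le> p" and q: "2 \<le> q" using perm_range[of a] by auto
  from assms(1) obtain m where m: "q = w m" "p \<in> {1..n}" "m \<in> {1..n}" "p < m" "w m < w p"
    unfolding northwest_corner_def by (auto elim: rotheE)
  have up: "(p - 1, w m) \<notin> rothe n w" and left: "(p, w (inv w (q - 1))) \<notin> rothe n w"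
    using assms(1) m unfolding northwest_corner_def perm_inv by auto
  have "p - 1 \<noteq> m" using m by auto
  then show "p - 1 \<in> nw_points n w (p, q)"
    using up p m perm_eq_iff[of "p - 1" m] unfolding inversion_in_rothe nw_points_def by auto
  have "q - 1 \<in> {1..n}" using q m perm_range[of m] by auto
  then have r: "inv w (q - 1) \<in> {1..n}" by (rule inv_range)
  have "inv w (q - 1) \<noteq> p" using m perm_inv(2)[of "q - 1"] by auto
  then show "inv w (q - 1) \<in> nw_points n w (p, q)"
    using left r q m unfolding inversion_in_rothe nw_points_def by (auto simp: perm_inv)
qed


section \<open>The conditions without regions\<close>

text \<open>If \<open>c\<close> had a single northwest point, in row \<open>a\<close>, then
  \<open>(a, w a)\<close> would be an outer corner with its diagonal neighbour in the diagram. The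
  additional northwest point of \<open>d\<close> puts \<open>d\<close> in another region, yet
  \<open>d\<close> lies beyond row \<open>a + 1\<close> and column \<open>w a + 1\<close>, against
  condition A.\<close>

lemma condition_A_imp:
  assumes A: "condition_A n w" and c: "c \<in> rothe n w" and d: "d \<in> rothe n w"
    and "fst c < fst d" "snd c < snd d" and "nw_points n w c \<noteq> {}" "rank_ge2 n w d"
  shows "rank_ge2 n w c"
proof (rule ccontr)
  assume not2: "\<not> rank_ge2 n w c"
  obtain i j i' j' where ij: "c = (i, j)" "d = (i', j')" by (cases c; cases d) auto
  obtain a where S: "nw_points n w c = {a}"
    using not2 assms(6) unfolding rank_ge2_def by blast
  then have a: "a \<in> {1..n}" "a < i" "w a < j" and wa: "1 \<le> w a"
    using ij perm_range[of a] by (auto simp: nw_points_def)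
  have only: "k = a" if "k \<in> {1..n}" "k < i" "w k < j" for k
    using S ij that by (auto simp: nw_points_def)
  have sq: "{a + 1..i} \<times> {w a + 1..j} \<subseteq> rothe n w"
    using c ij S a by (intro rothe_between) (auto simp: nw_points_def)
  have corner: "(a + 1, w a + 1) \<in> rothe n w"
    using a by (intro subsetD[OF sq]) auto
  have "outer_corner_at n w a"
    unfolding outer_corner_at_def
  proof (intro conjI impI)
    show "a \<in> {1..n}" by (rule a)
    \<comment> \<open>A point strictly northwest of \<open>(a, w a)\<close> is also northwest of
      \<open>c\<close>, hence lies in row \<open>a\<close> itself, which is absurd.\<close>
    have "k \<notin> nw_points n w (a, w a)" for k
      using only[of k] a by (auto simp: nw_points_def)
    then have empty: "nw_points n w (a, w a) = {}" by blast
    show "(a - 1, w a) \<in> dominant_part n w" if "1 < a"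
    proof -
      have "a - 1 \<in> {1..n}" using a that by auto
      moreover have "w (a - 1) > w a"
      proof (rule ccontr)
        assume "\<not> w (a - 1) > w a"
        then have "a - 1 = a" using \<open>a - 1 \<in> {1..n}\<close> a by (intro only) auto
        then show False using that by simp
      qed
      ultimately have "(a - 1, w a) \<in> rothe n w"
        using a that unfolding inversion_in_rothe by auto
      moreover have "nw_points n w (a - 1, w a) = {}"
        using empty by (auto simp: nw_points_def)
      ultimately show ?thesis by (simp add: dominant_part_eq)
    qed
    show "(a, w a - 1) \<in> dominant_part n w" if "1 < w a"
    proof -
      \<comment> \<open>The row of the point in column \<open>w a - 1\<close>: the transpose of the
        preceding argument about row \<open>a - 1\<close>.\<close>
      define r where "r = inv w (w a - 1)"
      have wr: "w r = w a - 1" by (simp add: r_def perm_inv)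
      have "r \<in> {1..n}"
        unfolding r_def using a that perm_range[of a] by (intro inv_range) auto
      moreover have "r > a"
      proof (rule ccontr)
        assume "\<not> r > a"
        moreover have "r \<noteq> a" using that wr by auto
        ultimately have "r = a" using \<open>r \<in> {1..n}\<close> a wr by (intro only) auto
        with \<open>r \<noteq> a\<close> show False by blast
      qed
      ultimately have "(a, w r) \<in> rothe n w"
        using a that wr unfolding inversion_in_rothe by auto
      moreover have "nw_points n w (a, w a - 1) = {}"
        using empty by (auto simp: nw_points_def)
      ultimately show ?thesis by (simp add: dominant_part_eq wr)
    qed
  qed
  moreover have "d \<notin> component (rothe n w) (a + 1, w a + 1)"
  proof
    assume "d \<in> component (rothe n w) (a + 1, w a + 1)"
    from nw_points_component[OF this] have "nw_points n w d \<subseteq> nw_points n w c"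
      using nw_points_mono[of "(a + 1, w a + 1)" c n w] ij a by simp
    then show False using assms(7) S unfolding rank_ge2_def by auto
  qed
  moreover have "component (rothe n w) (a + 1, w a + 1) \<in> regions (rothe n w)"
    using corner by (rule component_in_regions)
  moreover have "d \<in> {(i, j). (i, j) \<in> rothe n w \<and> a < i \<and> w a < j}"
    using d ij a assms(4,5) by simp
  ultimately have "i' = a + 1 \<or> j' = w a + 1"
    using A corner component_refl[of "(a + 1, w a + 1)" "rothe n w"]
    unfolding condition_A_def Let_def ij by blast
  then show False using a assms(4,5) ij by auto
qed

text \<open>Failure of (a) puts the point of row \<open>p - 1\<close> in column
  \<open>q - 1\<close>. A second northwest point \<open>b\<close> makes \<open>q\<close> at least 3,
  so failure of (b) puts the point of column \<open>q - 2\<close> below row \<open>p - 1\<close>.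
  Then \<open>b\<close> is northwest of \<open>(p - 1, q - 2)\<close> too.\<close>

lemma exceptional_corner:
  assumes nw: "northwest_corner n w p q" and rank: "rank_ge2 n w (p, q)"
    and exc: "\<not> (w (p - 1) \<noteq> q - 1 \<or> (q \<ge> 3 \<and> w (p - 1) = q - 1 \<and> inv w (q - 2) \<le> p - 2))"
  shows "(p - 1, q - 2) \<in> rothe n w" "nw_points n w (p - 1, q - 2) \<noteq> {}"
    "p - 1 < p" "q - 2 < q"
proof -
  note pts = northwest_corner_points[OF nw rank_ge2_nonempty[OF rank]]
  show "p - 1 < p" "q - 2 < q" using pts by auto
  obtain b where b: "b \<in> {1..n}" "b < p" "w b < q" "b \<noteq> p - 1"
    using rank unfolding rank_ge2_def nw_points_def by auto
  have p1: "w (p - 1) = q - 1" "p - 1 \<in> {1..n}" using exc pts by (auto simp: nw_points_def)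
  have "w b \<noteq> q - 1" using b p1 perm_eq_iff[of b "p - 1"] by auto
  then have wb: "1 \<le> w b" "w b \<le> q - 2" using b perm_range[of b] by auto
  then have r: "\<not> inv w (q - 2) \<le> p - 2" using exc by auto
  have wr: "w (inv w (q - 2)) = q - 2" by (simp add: perm_inv)
  have "inv w (q - 2) \<noteq> p - 1" using wr p1 wb by auto
  then have r': "p - 1 < inv w (q - 2)" using r by auto
  have "q \<le> n" using nw unfolding northwest_corner_def rothe_def by auto
  then have r_range: "inv w (q - 2) \<in> {1..n}" using wb by (intro inv_range) auto
  have "(p - 1, w (inv w (q - 2))) \<in> rothe n w"
    unfolding inversion_in_rothe using r' r_range p1 wb by (auto simp: perm_inv)
  then show "(p - 1, q - 2) \<in> rothe n w" by (simp add: wr)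
  have "w b \<noteq> q - 2" using wr b r' perm_eq_iff[of b "inv w (q - 2)"] by auto
  then have "b \<in> nw_points n w (p - 1, q - 2)"
    using b wb by (auto simp: nw_points_def)
  then show "nw_points n w (p - 1, q - 2) \<noteq> {}" by blast
qed

text \<open>A cell below row \<open>p\<close> and a cell right of column \<open>q\<close> refute the
  row-or-column alternative. They may be the same cell, as for a nested pair, or the two arms of a
  hook.\<close>

lemma condition_B_imp:
  assumes B: "condition_B n w" and nw: "northwest_corner n w p q" and rank: "rank_ge2 n w (p, q)"
    and side: "w (p - 1) \<noteq> q - 1 \<or> (q \<ge> 3 \<and> w (p - 1) = q - 1 \<and> inv w (q - 2) \<le> p - 2)"
    and c: "(i, j) \<in> rothe n w" "p < i" "q \<le> j"
    and d: "(i', j') \<in> rothe n w" "p \<le> i'" "q < j'"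
  shows False
proof -
  have pq: "(p, q) \<in> rothe n w" using nw unfolding northwest_corner_def by blast
  have "(p, q) \<notin> dominant_part n w"
    using rank rank_ge2_nonempty by (auto simp: dominant_part_eq)
  then have "component (rothe n w) (p, q) \<noteq> dominant_part n w"
    using component_refl by blast
  then have "\<exists>R\<in>regions (rothe n w). R \<noteq> dominant_part n w \<and> (p, q) \<in> R"
    using component_in_regions[OF pq] component_refl by blast
  with B nw side have
    "(\<forall>(i, j) \<in> {(i, j). (i, j) \<in> rothe n w \<and> i \<ge> p \<and> j \<ge> q}. i = p) \<or>
     (\<forall>(i, j) \<in> {(i, j). (i, j) \<in> rothe n w \<and> i \<ge> p \<and> j \<ge> q}. j = q)"
    unfolding condition_B_def Let_def by blast
  with c d show False by fastforce
qed

text \<open>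
  Condition B says nothing about a corner of rank at least 2 failing both (a) and (b), but such
  a corner yields a nested pair in a higher row, so a topmost nested pair is contradictory.
\<close>

lemma conditions_imp_not_nested:
  assumes A: "condition_A n w" and B: "condition_B n w"
    and "c \<in> rothe n w" "d \<in> rothe n w" "fst c < fst d" "snd c < snd d"
    and "nw_points n w c \<noteq> {}" "rank_ge2 n w d"
  shows False
  using assms(3-)
proof (induction "fst c" arbitrary: c rule: less_induct)
  case less
  have "rank_ge2 n w c" using condition_A_imp[OF A] less.prems by blast
  moreover obtain p q where pq: "northwest_corner n w p q" "p \<le> fst c" "q \<le> snd c"
      "nw_points n w (p, q) = nw_points n w c"
    using northwest_corner_exists[of "fst c" "snd c"] less.prems by auto
  ultimately have rank: "rank_ge2 n w (p, q)" by (simp add: rank_ge2_def)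
  show False
  proof (cases "w (p - 1) \<noteq> q - 1 \<or> (q \<ge> 3 \<and> w (p - 1) = q - 1 \<and> inv w (q - 2) \<le> p - 2)")
    case True
    then show False
      using condition_B_imp[OF B pq(1) rank, of "fst d" "snd d" "fst d" "snd d"] less.prems pq by simp
  next
    case False
    note exc = exceptional_corner[OF pq(1) rank False]
    \<comment> \<open>The second cell \<open>d\<close> is kept; the first one moves to row
      \<open>p - 1\<close>, strictly above that of \<open>c\<close>.\<close>
    show False
      using less.hyps[of "(p - 1, q - 2)"] less.prems exc pq by auto
  qed
qed

lemma conditions_iff_no_cells:
  "condition_A n w \<and> condition_B n w \<longleftrightarrow> \<not> nested_cells n w \<and> \<not> hook_cells n w"
proof (intro iffI conjI)
  assume AB: "condition_A n w \<and> condition_B n w"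
  note not_nested = conditions_imp_not_nested[OF conjunct1[OF AB] conjunct2[OF AB]]
  then show "\<not> nested_cells n w" unfolding nested_cells_def by blast
  show "\<not> hook_cells n w"
  proof
    assume "hook_cells n w"
    then obtain s t i j where st: "(s, t) \<in> rothe n w" "(i, t) \<in> rothe n w" "(s, j) \<in> rothe n w"
      "s < i" "t < j" "rank_ge2 n w (s, t)" unfolding hook_cells_def by blast
    obtain p q where pq: "northwest_corner n w p q" "p \<le> s" "q \<le> t"
        "nw_points n w (p, q) = nw_points n w (s, t)"
      using northwest_corner_exists st(1) by blast
    then have rank: "rank_ge2 n w (p, q)" using st by (simp add: rank_ge2_def)
    show False
    proof (cases "w (p - 1) \<noteq> q - 1 \<or> (q \<ge> 3 \<and> w (p - 1) = q - 1 \<and> inv w (q - 2) \<le> p - 2)")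
      case True
      then show False
        using condition_B_imp[OF conjunct2[OF AB] pq(1) rank, of i t s j] st pq by simp
    next
      case False
      note exc = exceptional_corner[OF pq(1) rank False]
      \<comment> \<open>The cell \<open>(p - 1, q - 2)\<close> and the corner \<open>(s, t)\<close>
        of the hook form a nested pair.\<close>
      show False
        using not_nested[of "(p - 1, q - 2)" "(s, t)"] exc pq st by auto
    qed
  qed
next
  assume no: "\<not> nested_cells n w \<and> \<not> hook_cells n w"
  show "condition_A n w"
    unfolding condition_A_def Let_def
  proof (clarify)
    fix p R i j
    assume p: "outer_corner_at n w p" "(p + 1, w p + 1) \<in> rothe n w"
      and R: "R \<in> regions (rothe n w)" "(p + 1, w p + 1) \<in> R"
      and ij: "(i, j) \<in> rothe n w" "p < i" "w p < j" "(i, j) \<notin> R"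
      and "j \<noteq> w p + 1"
    show "i = p + 1"
    proof (rule ccontr)
      assume "i \<noteq> p + 1"
      then have lt: "p + 1 < i" "w p + 1 < j" using ij \<open>j \<noteq> w p + 1\<close> by auto
      have p_in: "p \<in> nw_points n w (p + 1, w p + 1)"
        using p unfolding outer_corner_at_def nw_points_def by auto
      then have "\<not> rank_ge2 n w (i, j)"
        using no nested_cellsI[OF p(2) ij(1) lt] by blast
      moreover have "p \<in> nw_points n w (i, j)"
        using nw_points_mono[of "(p + 1, w p + 1)" "(i, j)"] p_in lt by auto
      \<comment> \<open>Since \<open>p\<close> is the only northwest point of \<open>(i, j)\<close>,
        a rectangle joins this cell to the diagonal neighbour of the outer corner, which puts it in
        \<open>R\<close>.\<close>
      ultimately have "nw_points n w (i, j) \<subseteq> {p}"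
        unfolding rank_ge2_def by blast
      then have "{p + 1..i} \<times> {w p + 1..j} \<subseteq> rothe n w"
        using ij p_in by (intro rothe_between) auto
      then have "(i, j) \<in> component (rothe n w) (p + 1, w p + 1)"
        using lt by (intro rectangle_component) auto
      then show False using region_eq_component[OF R] ij by simp
    qed
  qed
  show "condition_B n w"
    unfolding condition_B_def Let_def
  proof (intro allI impI, elim conjE bexE)
    fix p q R
    assume nw: "northwest_corner n w p q"
      and side: "w (p - 1) \<noteq> q - 1 \<or> (q \<ge> 3 \<and> w (p - 1) = q - 1 \<and> inv w (q - 2) \<le> p - 2)"
      and R: "R \<in> regions (rothe n w)" "R \<noteq> dominant_part n w" "(p, q) \<in> R"
    have pq: "(p, q) \<in> rothe n w" using nw unfolding northwest_corner_def by blast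
    have "(p, q) \<notin> dominant_part n w"
      using R dominant_part_component region_eq_component by blast
    then have "nw_points n w (p, q) \<noteq> {}" using pq by (simp add: dominant_part_eq)
    note pts = northwest_corner_points[OF nw this]
    \<comment> \<open>Under (a) the points of row \<open>p - 1\<close> and column
      \<open>q - 1\<close> are different; under (b) they coincide and column \<open>q - 2\<close>
      supplies the second point.\<close>
    have rank: "rank_ge2 n w (p, q)"
    proof (cases "w (p - 1) = q - 1")
      case False
      then have "inv w (q - 1) \<noteq> p - 1" using perm_inv(2)[of "q - 1"] by auto
      then show ?thesis using pts unfolding rank_ge2_def by blast
    next
      case True
      with side have q: "q \<ge> 3" "inv w (q - 2) \<le> p - 2" by auto
      have "q \<le> n" using pq unfolding rothe_def by auto
      then have "inv w (q - 2) \<in> {1..n}" using q by (intro inv_range) auto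
      then have "inv w (q - 2) \<in> nw_points n w (p, q)"
        using q pts(1,2) by (simp add: nw_points_def perm_inv)
      moreover have "inv w (q - 2) \<noteq> p - 1" using q pts by auto
      ultimately show ?thesis using pts unfolding rank_ge2_def by blast
    qed
    \<comment> \<open>Rank is monotone, so a cell strictly southeast of the corner would form a
      nested pair with it.\<close>
    have no_se: False if "(i, j) \<in> rothe n w" "p < i" "q < j" for i j
    proof -
      have "rank_ge2 n w (i, j)" using rank_ge2_mono[OF rank] that by auto
      then show False
        using no nested_cellsI[OF pq that rank_ge2_nonempty[OF rank]] by blast
    qed
    have no_hook: False if "(i, q) \<in> rothe n w" "(p, j) \<in> rothe n w" "p < i" "q < j" for i j
      using no pq rank that unfolding hook_cells_def by blast
    let ?D = "{(i, j). (i, j) \<in> rothe n w \<and> p \<le> i \<and> q \<le> j}"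
    show "((\<forall>(i, j)\<in>?D. i = p) \<or> (\<forall>(i, j)\<in>?D. j = q)) \<and>
        (\<forall>s t. (s, t) \<in> rothe n w \<and> s < p \<and> t < q \<longrightarrow> (s, t) \<in> dominant_part n w)"
    proof (intro conjI allI impI)
      show "(\<forall>(i, j)\<in>?D. i = p) \<or> (\<forall>(i, j)\<in>?D. j = q)"
      proof (rule ccontr)
        assume "\<not> ?thesis"
        then have "\<not> (\<forall>(i, j)\<in>?D. i = p)" and "\<not> (\<forall>(i, j)\<in>?D. j = q)"
          by blast+
        then obtain i j i' j' where c: "(i, j) \<in> rothe n w" "p < i" "q \<le> j"
          and d: "(i', j') \<in> rothe n w" "p \<le> i'" "q < j'"
          by (auto simp: le_less)
        have "j = q" using no_se[OF c(1,2)] c(3) by (cases "q < j") simp_all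
        moreover have "i' = p" using no_se[OF d(1) _ d(3)] d(2) by (cases "p < i'") simp_all
        ultimately show False using no_hook c d by blast
      qed
    next
      fix s t assume st: "(s, t) \<in> rothe n w \<and> s < p \<and> t < q"
      \<comment> \<open>Now \<open>(p, q)\<close> would be the southeastern cell of a nested
        pair.\<close>
      then have "nw_points n w (s, t) = {}"
        using no nested_cellsI[OF _ pq] rank by blast
      with st show "(s, t) \<in> dominant_part n w" by (simp add: dominant_part_eq)
    qed
  qed
qed


section \<open>The configurations as patterns\<close>

text \<open>The cells are \<open>(i, w k)\<close> and \<open>(i', w k')\<close>. The point
  \<open>x\<close> is northwest of the first, hence of both; \<open>y\<close> is another point
  northwest of the second and may be \<open>i\<close> or \<open>k\<close>.\<close>

lemma nested_cells_pointsE: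
  assumes "nested_cells n w"
  obtains i k i' k' x y where "{i, k, i', k', x, y} \<subseteq> {1..n}"
    "i < k" "w k < w i" "i' < k'" "w k' < w i'" "i < i'" "w k < w k'"
    "x < i" "w x < w k" "y \<noteq> x" "y < i'" "w y < w k'"
proof -
  from assms obtain c d where cd: "c \<in> rothe n w" "d \<in> rothe n w" "fst c < fst d" "snd c < snd d"
    and S: "nw_points n w c \<noteq> {}" "rank_ge2 n w d"
    unfolding nested_cells_def by blast
  obtain k where k: "snd c = w k" "fst c \<in> {1..n}" "k \<in> {1..n}" "fst c < k" "w k < w (fst c)"
    using cd(1) rotheE[of "fst c" "snd c"] by auto
  obtain k' where k': "snd d = w k'" "fst d \<in> {1..n}" "k' \<in> {1..n}" "fst d < k'" "w k' < w (fst d)"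
    using cd(2) rotheE[of "fst d" "snd d"] by auto
  from S(1) obtain x where x: "x \<in> {1..n}" "x < fst c" "w x < snd c" by (auto simp: nw_points_def)
  from S(2) obtain y where y: "y \<in> {1..n}" "y \<noteq> x" "y < fst d" "w y < snd d"
    unfolding rank_ge2_def nw_points_def by auto
  show ?thesis
    by (rule that[of "fst c" k "fst d" k' x y]) (use k k' x y cd in simp_all)
qed

lemma nested_cells_pointsI:
  assumes "{i, k, i', k', x, y} \<subseteq> {1..n}"
    "i < k" "w k < w i" "i' < k'" "w k' < w i'" "i < i'" "w k < w k'"
    "x < i" "w x < w k" "y \<noteq> x" "y < i'" "w y < w k'"
  shows "nested_cells n w"
proof (rule nested_cellsI)
  show "(i, w k) \<in> rothe n w" "(i', w k') \<in> rothe n w"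
    using assms by (simp_all add: inversion_in_rothe)
  have "x \<in> nw_points n w (i, w k)" "x \<in> nw_points n w (i', w k')" "y \<in> nw_points n w (i', w k')"
    using assms by (simp_all add: nw_points_def)
  then show "nw_points n w (i, w k) \<noteq> {}" "rank_ge2 n w (i', w k')"
    using assms(10) unfolding rank_ge2_def by blast+
qed (use assms in simp_all)

text \<open>The corner is \<open>(p, w k)\<close>, the arms are \<open>(i, w k)\<close> and
  \<open>(p, w m)\<close>; \<open>i\<close> and \<open>m\<close> may coincide.\<close>

lemma hook_cells_pointsE:
  assumes "hook_cells n w"
  obtains p k i m x y where "{p, k, i, m, x, y} \<subseteq> {1..n}"
    "p < i" "i < k" "p < m" "w k < w p" "w k < w i" "w k < w m" "w m < w p"
    "x < y" "y < p" "w x < w k" "w y < w k"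
proof -
  from assms obtain p q i j where c: "(p, q) \<in> rothe n w" "(i, q) \<in> rothe n w" "(p, j) \<in> rothe n w"
    and lt: "p < i" "q < j" and S: "rank_ge2 n w (p, q)"
    unfolding hook_cells_def by blast
  from c(1) obtain k where k: "q = w k" "p \<in> {1..n}" "k \<in> {1..n}" "p < k" "w k < w p" by (rule rotheE)
  from c(3) obtain m where m: "j = w m" "m \<in> {1..n}" "p < m" "w m < w p" by (rule rotheE)
  from c(2) have i: "i \<in> {1..n}" "i < k" "w k < w i" by (simp_all add: k(1) inversion_in_rothe)
  obtain x y where "x \<in> nw_points n w (p, q)" "y \<in> nw_points n w (p, q)" "x < y"
    using S unfolding rank_ge2_def by (metis linorder_neqE_nat)
  then have xy: "{x, y} \<subseteq> {1..n}" "x < y" "y < p" "w x < w k" "w y < w k"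
    using k by (auto simp: nw_points_def)
  show ?thesis
    by (rule that[of p k i m x y]) (use k m i xy lt in simp_all)
qed

lemma hook_cells_pointsI:
  assumes "{p, k, i, m, x, y} \<subseteq> {1..n}"
    "p < i" "i < k" "p < m" "w k < w p" "w k < w i" "w k < w m" "w m < w p"
    "x < y" "y < p" "w x < w k" "w y < w k"
  shows "hook_cells n w"
proof -
  have "(p, w k) \<in> rothe n w" "(i, w k) \<in> rothe n w" "(p, w m) \<in> rothe n w"
    using assms by (simp_all add: inversion_in_rothe)
  moreover have "x \<in> nw_points n w (p, w k)" "y \<in> nw_points n w (p, w k)"
    using assms by (simp_all add: nw_points_def)
  then have "rank_ge2 n w (p, w k)" using less_imp_neq[OF assms(9)] unfolding rank_ge2_def by blast
  ultimately show ?thesis using assms(2,7) unfolding hook_cells_def by blast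
qed

text \<open>\<open>sorted_wrt\<close> compares every earlier entry with every later one, so that for
  concrete lists simplification yields plain inequalities.\<close>

definition order_iso :: "nat list \<Rightarrow> nat list \<Rightarrow> bool" where
  "order_iso ps v \<longleftrightarrow>
     sorted_wrt (\<lambda>(p, a) (q, b). p < q \<and> (if a < b then w p < w q else w q < w p)) (zip ps v)"

text \<open>Distinctness matters: equal entries of \<open>v\<close> would demand equal values in
  \<open>contains_pattern\<close>, but a strict descent in \<open>order_iso\<close>.\<close>

lemma contains_pattern_iff:
  assumes "distinct v"
  shows "contains_pattern n w v \<longleftrightarrow>
    (\<exists>ps. length ps = length v \<and> set ps \<subseteq> {1..n} \<and> order_iso ps v)"
proof
  assume "contains_pattern n w v"
  then obtain f where f: "strict_mono_on {..<length v} f" "f ` {..<length v} \<subseteq> {1..n}"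
    "\<forall>a<length v. \<forall>b<length v. w (f a) < w (f b) \<longleftrightarrow> v ! a < v ! b"
    unfolding contains_pattern_def by blast
  moreover have "v ! b < v ! a" if "a < b" "b < length v" "\<not> v ! a < v ! b" for a b
    using assms that by (auto simp: le_less not_less nth_eq_iff_index_eq)
  ultimately have "order_iso (map f [0..<length v]) v"
    unfolding order_iso_def sorted_wrt_iff_nth_less by (auto simp: strict_mono_on_def)
  with f(2) show "\<exists>ps. length ps = length v \<and> set ps \<subseteq> {1..n} \<and> order_iso ps v"
    by (intro exI[of _ "map f [0..<length v]"]) (auto simp: atLeast0LessThan)
next
  assume "\<exists>ps. length ps = length v \<and> set ps \<subseteq> {1..n} \<and> order_iso ps v"
  then obtain ps where ps: "length ps = length v" "set ps \<subseteq> {1..n}"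
    and iso: "\<And>a b. a < b \<Longrightarrow> b < length v \<Longrightarrow> ps ! a < ps ! b \<and>
      (if v ! a < v ! b then w (ps ! a) < w (ps ! b) else w (ps ! b) < w (ps ! a))"
    unfolding order_iso_def sorted_wrt_iff_nth_less by auto
  have "w (ps ! a) < w (ps ! b) \<longleftrightarrow> v ! a < v ! b" if "a < length v" "b < length v" for a b
  proof (cases a b rule: linorder_cases)
    case less
    with iso[of a b] that show ?thesis by (auto split: if_splits)
  next
    case greater
    have "v ! a \<noteq> v ! b" using greater that assms by (simp add: nth_eq_iff_index_eq)
    then show ?thesis using iso[of b a] greater that by (auto split: if_splits)
  qed simp
  with ps iso show "contains_pattern n w v"
    unfolding contains_pattern_def
    by (intro exI[of _ "\<lambda>a. ps ! a"]) (auto simp: strict_mono_on_def)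
qed

lemma distinct_patterns: "v \<in> patterns \<Longrightarrow> distinct v"
  unfolding patterns_def by auto

section \<open>From the configurations to the patterns\<close>

lemma not_avoidsI:
  assumes "v \<in> patterns" "length ps = length v" "set ps \<subseteq> {1..n}" "order_iso ps v"
  shows "\<not> avoids_patterns n w"
  using assms contains_pattern_iff[OF distinct_patterns] unfolding avoids_patterns_def by blast

text \<open>The relative order of the two low points is free, which merges \<open>12543\<close> with
  \<open>21543\<close>.\<close>

lemma two_below_321:
  assumes "{x, y, a, b, c} \<subseteq> {1..n}" "x < y" "y < a" "a < b" "b < c"
    and "w c < w b" "w b < w a" "w x < w c" "w y < w c"
  shows "\<not> avoids_patterns n w"
proof (cases "w x < w y")
  case True
  show ?thesis
    by (rule not_avoidsI[of "[1,2,5,4,3]" "[x,y,a,b,c]"])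
      (use True assms in \<open>simp_all add: patterns_def order_iso_def\<close>)
next
  case False
  moreover have "w x \<noteq> w y" using assms by (simp add: perm_eq_iff)
  ultimately show ?thesis
    by (intro not_avoidsI[of "[2,1,5,4,3]" "[x,y,a,b,c]"])
      (use assms in \<open>simp_all add: patterns_def order_iso_def\<close>)
qed

text \<open>Likewise merges \<open>125634\<close> with \<open>215634\<close>.\<close>

lemma two_below_3412:
  assumes "{x, y, a, b, c, d} \<subseteq> {1..n}" "x < y" "y < a" "a < b" "b < c" "c < d"
    and "w c < w d" "w d < w a" "w a < w b" "w x < w c" "w y < w c"
  shows "\<not> avoids_patterns n w"
proof (cases "w x < w y")
  case True
  show ?thesis
    by (rule not_avoidsI[of "[1,2,5,6,3,4]" "[x,y,a,b,c,d]"])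
      (use True assms in \<open>simp_all add: patterns_def order_iso_def\<close>)
next
  case False
  moreover have "w x \<noteq> w y" using assms by (simp add: perm_eq_iff)
  ultimately show ?thesis
    by (intro not_avoidsI[of "[2,1,5,6,3,4]" "[x,y,a,b,c,d]"])
      (use assms in \<open>simp_all add: patterns_def order_iso_def\<close>)
qed

text \<open>Rows \<open>p, i, k\<close> or \<open>p, m, k\<close> form a 321 above the two low
  points, unless \<open>w p < w i\<close> and \<open>k < m\<close>; then \<open>p, i, k, m\<close>
  form a 3412.\<close>

lemma hook_imp_not_avoids:
  assumes "hook_cells n w"
  shows "\<not> avoids_patterns n w"
proof -
  from assms obtain p k i m x y where *: "{p, k, i, m, x, y} \<subseteq> {1..n}"
    "p < i" "i < k" "p < m" "w k < w p" "w k < w i" "w k < w m" "w m < w p"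
    "x < y" "y < p" "w x < w k" "w y < w k"
    by (rule hook_cells_pointsE)
  have "m \<noteq> k" "w i \<noteq> w p" using * by (auto simp: perm_eq_iff)
  then consider "w i < w p" | "m < k" | "w p < w i" "k < m" by linarith
  then show ?thesis
  proof cases
    case 1
    show ?thesis using two_below_321[of x y p i k] 1 * by simp
  next
    case 2
    show ?thesis using two_below_321[of x y p m k] 2 * by simp
  next
    case 3
    show ?thesis using two_below_3412[of x y p i k m] 3 * by simp
  qed
qed

text \<open>In cases 1 to 5 the points \<open>x, i, k, i', k'\<close> already form a pattern. Case 6
  is the one in which \<open>(i, w k')\<close> and \<open>(i', w k)\<close> are diagram cells as
  well; there the position of \<open>y\<close> decides.\<close>

lemma nested_imp_not_avoids:
  assumes "nested_cells n w"
  shows "\<not> avoids_patterns n w"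
proof -
  from assms obtain i k i' k' x y where *: "{i, k, i', k', x, y} \<subseteq> {1..n}"
    "i < k" "w k < w i" "i' < k'" "w k' < w i'" "i < i'" "w k < w k'"
    "x < i" "w x < w k" and y: "y \<noteq> x" "y < i'" "w y < w k'"
    by (rule nested_cells_pointsE)
  have ne: "k \<noteq> k'" "k \<noteq> i'" "w i \<noteq> w k'" "w i \<noteq> w i'"
    using * by (auto simp: perm_eq_iff)
  then consider "k < i'" "w i < w k'" | "i' < k" "k < k'" "w i < w k'" | "k' < k" "w i < w k'"
    | "k < i'" "w k' < w i" "w i < w i'" | "k < i'" "w i' < w i"
    | "i' < k" "w k' < w i"
    using * by linarith
  then show ?thesis
  proof cases
    case 1
    show ?thesis
      by (rule not_avoidsI[of "[1,3,2,5,4]" "[x,i,k,i',k']"])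
        (use 1 * in \<open>simp_all add: patterns_def order_iso_def\<close>)
  next
    case 2
    show ?thesis
      by (rule not_avoidsI[of "[1,3,5,2,4]" "[x,i,i',k,k']"])
        (use 2 * in \<open>simp_all add: patterns_def order_iso_def\<close>)
  next
    case 3
    show ?thesis
      by (rule not_avoidsI[of "[1,3,5,4,2]" "[x,i,i',k',k]"])
        (use 3 * in \<open>simp_all add: patterns_def order_iso_def\<close>)
  next
    case 4
    show ?thesis
      by (rule not_avoidsI[of "[1,4,2,5,3]" "[x,i,k,i',k']"])
        (use 4 * in \<open>simp_all add: patterns_def order_iso_def\<close>)
  next
    case 5
    show ?thesis
      by (rule not_avoidsI[of "[1,5,2,4,3]" "[x,i,k,i',k']"])
        (use 5 * in \<open>simp_all add: patterns_def order_iso_def\<close>)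
  next
    case ik: 6
    have yne: "y \<noteq> i" "w y \<noteq> w k" "w y \<noteq> w x"
      using ik y by (auto simp: perm_eq_iff)
    \<comment> \<open>In \<open>low\<close> the point \<open>y\<close> is also northwest of the
      first cell. It is too far right for that in \<open>left\<close> and \<open>mid\<close>, too
      far down in \<open>right_low\<close> and \<open>right_mid\<close>, and both in
      \<open>right_high\<close>.\<close>
    then consider (low) "y < i" "w y < w k"
      | (left) "y < x" "w k < w y" | (mid) "x < y" "y < i" "w k < w y"
      | (right_low) "i < y" "w y < w x" | (right_mid) "i < y" "w x < w y" "w y < w k"
      | (right_high) "i < y" "w k < w y"
      using y by linarith
    then show ?thesis
    proof cases
      case low
      obtain s t where st: "{s, t} \<subseteq> {1..n}" "s < t" "t < i" "w s < w k" "w t < w k"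
      proof (cases "x < y")
        case True
        with that[of x y] low * show ?thesis by simp
      next
        case False
        with that[of y x] low * y show ?thesis by simp
      qed
      consider "w i' < w i" | "k' < k" | "w i < w i'" "k < k'" using ne by linarith
      then show ?thesis
      proof cases
        case 1
        show ?thesis using two_below_321[of s t i i' k'] 1 st * by simp
      next
        case 2
        show ?thesis using two_below_321[of s t i k' k] 2 st ik * by simp
      next
        case 3
        show ?thesis using two_below_3412[of s t i i' k k'] 3 st ik * by simp
      qed
    next
      case left
      consider "w i' < w i" | "w i < w i'" "k < k'" | "w i < w i'" "k' < k" using ne by linarith
      then show ?thesis
      proof cases
        case 1
        show ?thesis using two_below_321[of y x i i' k'] 1 left y * by simp
      next
        case 2
        show ?thesis
          by (rule not_avoidsI[of "[3,1,5,6,2,4]" "[y,x,i,i',k,k']"])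
            (use 2 left y ik * in \<open>simp_all add: patterns_def order_iso_def\<close>)
      next
        case 3
        show ?thesis
          by (rule not_avoidsI[of "[3,1,5,6,4,2]" "[y,x,i,i',k',k]"])
            (use 3 left y ik * in \<open>simp_all add: patterns_def order_iso_def\<close>)
      qed
    next
      case mid
      \<comment> \<open>Here \<open>y\<close> takes the place of \<open>i\<close>, which leads back
        to the patterns of cases 2 and 3.\<close>
      show ?thesis
      proof (cases "k < k'")
        case True
        show ?thesis
          by (rule not_avoidsI[of "[1,3,5,2,4]" "[x,y,i',k,k']"])
            (use True mid y ik * in \<open>simp_all add: patterns_def order_iso_def\<close>)
      next
        case False
        show ?thesis
          by (rule not_avoidsI[of "[1,3,5,4,2]" "[x,y,i',k',k]"])
            (use False ne mid y ik * in \<open>simp_all add: patterns_def order_iso_def\<close>)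
      qed
    next
      case right_low
      consider "k' < k" | "w i < w i'" "k < k'" | "w i' < w i" "k < k'" using ne by linarith
      then show ?thesis
      proof cases
        case 1
        show ?thesis using two_below_321[of x y i' k' k] 1 right_low y * by simp
      next
        case 2
        show ?thesis
          by (rule not_avoidsI[of "[2,5,1,6,3,4]" "[x,i,y,i',k,k']"])
            (use 2 right_low y ik * in \<open>simp_all add: patterns_def order_iso_def\<close>)
      next
        case 3
        show ?thesis
          by (rule not_avoidsI[of "[2,6,1,5,3,4]" "[x,i,y,i',k,k']"])
            (use 3 right_low y ik * in \<open>simp_all add: patterns_def order_iso_def\<close>)
      qed
    next
      case right_mid
      \<comment> \<open>Here and in the next case \<open>y\<close> takes the place of
        \<open>k\<close>, which leads back to the patterns of cases 4 and 5.\<close>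
      show ?thesis
      proof (cases "w i < w i'")
        case True
        show ?thesis
          by (rule not_avoidsI[of "[1,4,2,5,3]" "[x,i,y,i',k']"])
            (use True right_mid y ik * in \<open>simp_all add: patterns_def order_iso_def\<close>)
      next
        case False
        show ?thesis
          by (rule not_avoidsI[of "[1,5,2,4,3]" "[x,i,y,i',k']"])
            (use False ne right_mid y ik * in \<open>simp_all add: patterns_def order_iso_def\<close>)
      qed
    next
      case right_high
      show ?thesis
      proof (cases "w i < w i'")
        case True
        show ?thesis
          by (rule not_avoidsI[of "[1,4,2,5,3]" "[x,i,y,i',k']"])
            (use True right_high y ik * in \<open>simp_all add: patterns_def order_iso_def\<close>)
      next
        case False
        show ?thesis
          by (rule not_avoidsI[of "[1,5,2,4,3]" "[x,i,y,i',k']"])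
            (use False ne right_high y ik * in \<open>simp_all add: patterns_def order_iso_def\<close>)
      qed
    qed
  qed
qed

section \<open>From the patterns back to the configurations\<close>

lemma order_iso_length5E:
  assumes "length ps = length v" "set ps \<subseteq> {1..n}" "order_iso ps v" "length v = 5"
  obtains a b c d e where "{a, b, c, d, e} \<subseteq> {1..n}" "order_iso [a, b, c, d, e] v"
proof -
  obtain a b c d e where "ps = [a, b, c, d, e]"
    using assms by (auto simp: numeral_eq_Suc length_Suc_conv)
  with assms that[of a b c d e] show ?thesis by simp
qed

lemma order_iso_length6E:
  assumes "length ps = length v" "set ps \<subseteq> {1..n}" "order_iso ps v" "length v = 6"
  obtains a b c d e f where "{a, b, c, d, e, f} \<subseteq> {1..n}" "order_iso [a, b, c, d, e, f] v"
proof -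
  obtain a b c d e f where "ps = [a, b, c, d, e, f]"
    using assms by (auto simp: numeral_eq_Suc length_Suc_conv)
  with assms that[of a b c d e f] show ?thesis by simp
qed

text \<open>Five points suffice for a nested pair because its second northwest point is reused: it
  is \<open>b\<close>, the row of the first cell, or, for \<open>14253\<close> and
  \<open>15243\<close>, the point \<open>c\<close> at the foot of that cell's column.\<close>

lemma length5_pattern_imp:
  assumes "{a, b, c, d, e} \<subseteq> {1..n}" "order_iso [a, b, c, d, e] v" "v \<in> patterns" "length v = 5"
  shows "nested_cells n w \<or> hook_cells n w"
proof -
  consider "v = [1,2,5,4,3] \<or> v = [2,1,5,4,3]" | "v = [1,3,2,5,4]" | "v = [1,3,5,2,4]"
    | "v = [1,3,5,4,2]" | "v = [1,4,2,5,3] \<or> v = [1,5,2,4,3]"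
    using assms(3,4) unfolding patterns_def insert_iff empty_iff by (elim disjE) simp_all
  then show ?thesis
  proof cases
    case 1
    \<comment> \<open>The single point \<open>d\<close> provides both arms of the hook.\<close>
    then show ?thesis using assms(1,2) unfolding order_iso_def
      by (intro disjI2 hook_cells_pointsI[of c e d d a b]) auto
  next
    case 2
    then show ?thesis using assms(1,2) unfolding order_iso_def
      by (intro disjI1 nested_cells_pointsI[of b c d e a b]) auto
  next
    case 3
    then show ?thesis using assms(1,2) unfolding order_iso_def
      by (intro disjI1 nested_cells_pointsI[of b d c e a b]) auto
  next
    case 4
    then show ?thesis using assms(1,2) unfolding order_iso_def
      by (intro disjI1 nested_cells_pointsI[of b e c d a b]) auto
  next
    case 5
    then show ?thesis using assms(1,2) unfolding order_iso_def
      by (intro disjI1 nested_cells_pointsI[of b c d e a c]) auto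
  qed
qed

text \<open>All six points have separate roles here. In the nested cases the additional northwest
  point is \<open>a\<close> for the patterns starting with 3, and \<open>c\<close> for those
  starting with 2.\<close>

lemma length6_pattern_imp:
  assumes "{a, b, c, d, e, f} \<subseteq> {1..n}" "order_iso [a, b, c, d, e, f] v" "v \<in> patterns" "length v = 6"
  shows "nested_cells n w \<or> hook_cells n w"
proof -
  consider "v = [1,2,5,6,3,4] \<or> v = [2,1,5,6,3,4]" | "v = [3,1,5,6,2,4]" | "v = [3,1,5,6,4,2]"
    | "v = [2,5,1,6,3,4] \<or> v = [2,6,1,5,3,4]"
    using assms(3,4) unfolding patterns_def insert_iff empty_iff by (elim disjE) simp_all
  then show ?thesis
  proof cases
    case 1
    then show ?thesis using assms(1,2) unfolding order_iso_def
      by (intro disjI2 hook_cells_pointsI[of c e d f a b]) auto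
  next
    case 2
    then show ?thesis using assms(1,2) unfolding order_iso_def
      by (intro disjI1 nested_cells_pointsI[of c e d f b a]) auto
  next
    case 3
    then show ?thesis using assms(1,2) unfolding order_iso_def
      by (intro disjI1 nested_cells_pointsI[of c f d e b a]) auto
  next
    case 4
    then show ?thesis using assms(1,2) unfolding order_iso_def
      by (intro disjI1 nested_cells_pointsI[of b e d f a c]) auto
  qed
qed

lemma avoids_iff_no_cells: "avoids_patterns n w \<longleftrightarrow> \<not> nested_cells n w \<and> \<not> hook_cells n w"
proof
  assume "avoids_patterns n w"
  then show "\<not> nested_cells n w \<and> \<not> hook_cells n w"
    using nested_imp_not_avoids hook_imp_not_avoids by blast
next
  assume no: "\<not> nested_cells n w \<and> \<not> hook_cells n w"
  show "avoids_patterns n w"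
    unfolding avoids_patterns_def
  proof (intro ballI notI)
    fix v assume v: "v \<in> patterns" "contains_pattern n w v"
    then obtain ps where ps: "length ps = length v" "set ps \<subseteq> {1..n}" "order_iso ps v"
      using contains_pattern_iff distinct_patterns by blast
    consider "length v = 5" | "length v = 6" using v(1) unfolding patterns_def by auto
    then show False
    proof cases
      case 1
      with ps obtain a b c d e where "{a, b, c, d, e} \<subseteq> {1..n}" "order_iso [a, b, c, d, e] v"
        by (rule order_iso_length5E)
      from length5_pattern_imp[OF this v(1) 1] no show False by blast
    next
      case 2
      with ps obtain a b c d e f where "{a, b, c, d, e, f} \<subseteq> {1..n}" "order_iso [a, b, c, d, e, f] v"
        by (rule order_iso_length6E)
      from length6_pattern_imp[OF this v(1) 2] no show False by blast
    qed
  qed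
qed

end

theorem theorem4p5:
  fixes n :: nat and w :: "nat \<Rightarrow> nat"
  assumes "w permutes {1..n}"
  shows "avoids_patterns n w \<longleftrightarrow> condition_A n w \<and> condition_B n w"
  using avoids_iff_no_cells[OF assms] conditions_iff_no_cells[OF assms] by simp

end
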